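(* Let $A\in\mathbb{R}^{m\times n}$ with $2\le m<n$ be any matrix with nonzero columns. Then $\mu_*(A)>0$, and $$1+\frac{1}{\mu_W(A)}\ \le\ 1+\frac{1}{\mu_*(A)}\ \le\ \mathrm{Spark}(A)$$ for any nonsingular matrix $W\in\mathbb{R}^{m\times m}$. Hence, for $b\in\mathbb{R}^m$, if the system $Ax=b$ has a solution $x$ satisfying $$\|x\|_0<\left(1+\frac{1}{\mu_*(A)}\right)/2,$$ or more restrictively, if there is a nonsingular matrix $W\in\mathbb{R}^{m\times m}$ such that $\|x\|_0<\left(1+\frac{1}{\mu_W(A)}\right)/2$, then $x$ is the unique sparsest solution to the linear system.
   Context: For a matrix $M\in\mathbb{R}^{m\times n}$ with nonzero columns $c_1,\dots,c_n$, the mutual coherence is $\mu(M)=\max_{i\ne j}\frac{|c_i^Tc_j|}{\|c_i\|_2\|c_j\|_2}$. For nonsingular $W\in\mathbb{R}^{m\times m}$, the scaled mutual coherence is $\mu_W(A)=\mu(WA)$. The optimal scaled mutual coherence is $\mu_*(A)=\inf\{\mu_W(A): W\in\mathbb{R}^{m\times m}\text{ nonsingular}\}$. $\mathrm{Spark}(A)$ is the smallest number of columns of $A$ that are linearly dependent. $\|x\|_0$ is the number of nonzero components of $x$. A solution $x$ of $Ax=b$ is the unique sparsest solution if $\|x\|_0<\|y\|_0$ for every solution $y\ne x$ of $Ay=b$. *)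

theory Defs
  imports "HOL-Analysis.Analysis"
begin

text \<open>The maximum is over a nonempty set as soon as the matrix has at least two columns.\<close>

definition mutual_coherence :: "real^'n^'m \<Rightarrow> real" where
  "mutual_coherence M =
     Max {\<bar>column i M \<bullet> column j M\<bar> / (norm (column i M) * norm (column j M)) | i j. i \<noteq> j}"

definition scaled_coherence :: "real^'m^'m \<Rightarrow> real^'n^'m \<Rightarrow> real" where
  "scaled_coherence W A = mutual_coherence (W ** A)"

definition optimal_coherence :: "real^'n^'m \<Rightarrow> real" where
  "optimal_coherence A = Inf {scaled_coherence W A | W. invertible W}"

text \<open>Linear dependence is that of the indexed family of columns, so that two equal columns
  are dependent. The library predicate \<^const>\<open>dependent\<close> on the set \<^const>\<open>columns\<close> would
  identify them.\<close>

definition columns_dependent :: "real^'n^'m \<Rightarrow> 'n set \<Rightarrow> bool" where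
  "columns_dependent A S \<longleftrightarrow>
     (\<exists>c. (\<exists>j\<in>S. c j \<noteq> 0) \<and> (\<Sum>j\<in>S. c j *\<^sub>R column j A) = 0)"

text \<open>The value is unspecified if all columns together are linearly independent; this cannot
  happen when the matrix has more columns than rows.\<close>

definition spark :: "real^'n^'m \<Rightarrow> nat" where
  "spark A = (LEAST k. \<exists>S. card S = k \<and> columns_dependent A S)"

definition l0 :: "real^'n \<Rightarrow> nat" where
  "l0 x = card {i. x $ i \<noteq> 0}"

definition unique_sparsest_solution :: "real^'n^'m \<Rightarrow> real^'m \<Rightarrow> real^'n \<Rightarrow> bool" where
  "unique_sparsest_solution A b x \<longleftrightarrow>
     A *v x = b \<and> (\<forall>y. A *v y = b \<and> y \<noteq> x \<longrightarrow> l0 x < l0 y)"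

end

theory Submission
  imports Defs
begin

text \<open>Suppose the columns indexed by \<open>S\<close> satisfy a nontrivial linear relation. Scale the columns
  to unit length and take the inner product of the relation with the column whose coefficient is
  largest in absolute value: that coefficient is a combination of the \<open>card S - 1\<close> other
  ones, with weights of absolute value bounded by the coherence. Hence \<open>1 \<le> (card S - 1) * \<mu>\<close>
  (\<open>dependent_columns_coherence\<close>).

  Multiplication by a nonsingular \<open>W\<close> preserves linear relations among columns, so the bound holds
  for every \<open>\<mu>\<^sub>W\<close> with the same \<open>S\<close>. A smallest dependent \<open>S\<close>, which exists because there are
  more columns than rows, gives the lower bound \<open>1 / (Spark - 1)\<close>, uniform in \<open>W\<close>. It therefore
  passes to the infimum, and this yields both the positivity of the optimal coherence and the
  bound on the spark.

  For uniqueness, the difference of two solutions is in the kernel, so its support is a dependent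
  set of columns. Two distinct solutions thus have together at least \<open>Spark\<close> nonzero components,
  and a solution with fewer than \<open>Spark / 2\<close> of them beats all others
  (\<open>unique_sparsest_solution_if_l0_less_spark\<close>).\<close>

section \<open>Coherence of linearly dependent columns\<close>

lemma normalized_inner_le_coherence:
  fixes M :: "real^'n^'m"
  assumes "i \<noteq> j"
  shows "\<bar>column i M \<bullet> column j M\<bar> / (norm (column i M) * norm (column j M)) \<le> mutual_coherence M"
proof -
  let ?f = "\<lambda>(i, j). \<bar>column i M \<bullet> column j M\<bar> / (norm (column i M) * norm (column j M))"
  have "{\<bar>column i M \<bullet> column j M\<bar> / (norm (column i M) * norm (column j M)) | i j. i \<noteq> j}
          \<subseteq> range ?f"
    by auto
  then have "finite {\<bar>column i M \<bullet> column j M\<bar> / (norm (column i M) * norm (column j M)) | i j. i \<noteq> j}"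
    by (rule finite_subset) simp
  with assms show ?thesis
    unfolding mutual_coherence_def by (intro Max_ge) auto
qed

text \<open>Pairing the relation with the dominant term bounds that term by the sum of the others, each
  of which is damped by the coherence.\<close>

lemma dependent_columns_coherence:
  fixes M :: "real^'n^'m"
  assumes nonzero: "\<And>j. column j M \<noteq> 0" and "columns_dependent M S"
  shows "1 \<le> (real (card S) - 1) * mutual_coherence M"
proof -
  let ?\<mu> = "mutual_coherence M" and ?N = "\<lambda>j. norm (column j M)"
  obtain c i where i: "i \<in> S" "c i \<noteq> 0" and rel: "(\<Sum>j\<in>S. c j *\<^sub>R column j M) = 0"
    using assms(2) unfolding columns_dependent_def by blast
  define t where "t j = \<bar>c j\<bar> * ?N j" for j
  have "\<exists>k\<in>S. \<forall>j\<in>S. t j \<le> t k"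
  proof -
    have "Max (t ` S) \<in> t ` S"
      using i by (intro Max_in) auto
    then obtain k where "k \<in> S" "Max (t ` S) = t k"
      by auto
    then show ?thesis
      by (metis Max_ge finite finite_imageI imageI)
  qed
  then obtain k where k: "k \<in> S" and max: "\<And>j. j \<in> S \<Longrightarrow> t j \<le> t k"
    by blast
  have "0 < t i"
    using i nonzero by (simp add: t_def)
  then have tk: "0 < t k"
    using max[OF i(1)] by linarith
  have Nk: "0 < ?N k"
    using nonzero by simp
  have term_le: "\<bar>c j * (column j M \<bullet> column k M)\<bar> \<le> t k * ?N k * ?\<mu>" if "j \<in> S - {k}" for j
  proof -
    have Nj: "0 < ?N j"
      using nonzero by simp
    have coh: "\<bar>column j M \<bullet> column k M\<bar> / (?N j * ?N k) \<le> ?\<mu>"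
      using that by (intro normalized_inner_le_coherence) auto
    \<comment> \<open>The sign of the coherence comes from this pair of columns: the maximum over no pairs has no
      specified value.\<close>
    have "0 \<le> \<bar>column j M \<bullet> column k M\<bar> / (?N j * ?N k)"
      by simp
    then have mu: "0 \<le> ?\<mu>"
      using coh by linarith
    have "\<bar>column j M \<bullet> column k M\<bar> \<le> ?\<mu> * (?N j * ?N k)"
      using coh Nj Nk by (simp add: pos_divide_le_eq)
    then have "\<bar>c j * (column j M \<bullet> column k M)\<bar> \<le> \<bar>c j\<bar> * (?\<mu> * (?N j * ?N k))"
      unfolding abs_mult by (rule mult_left_mono) simp
    also have "\<dots> = t j * (?N k * ?\<mu>)"
      by (simp add: t_def)
    also have "\<dots> \<le> t k * (?N k * ?\<mu>)"
      using max that mu by (intro mult_right_mono) auto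
    finally show ?thesis
      by (simp add: mult.assoc)
  qed
  have "0 = (\<Sum>j\<in>S. c j *\<^sub>R column j M) \<bullet> column k M"
    using rel by simp
  also have "\<dots> = (\<Sum>j\<in>S. c j * (column j M \<bullet> column k M))"
    by (simp add: inner_sum_left)
  also have "\<dots> = c k * (column k M \<bullet> column k M)
      + (\<Sum>j\<in>S - {k}. c j * (column j M \<bullet> column k M))"
    using k by (simp add: sum.remove)
  finally have "\<bar>c k * (column k M \<bullet> column k M)\<bar>
      = \<bar>\<Sum>j\<in>S - {k}. c j * (column j M \<bullet> column k M)\<bar>"
    by linarith
  moreover have "\<bar>c k * (column k M \<bullet> column k M)\<bar> = t k * ?N k"
    by (simp add: t_def abs_mult dot_square_norm power2_eq_square)
  ultimately have "t k * ?N k = \<bar>\<Sum>j\<in>S - {k}. c j * (column j M \<bullet> column k M)\<bar>"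
    by simp
  also have "\<dots> \<le> (\<Sum>j\<in>S - {k}. t k * ?N k * ?\<mu>)"
    by (rule order_trans[OF sum_abs sum_mono]) (rule term_le)
  also have "\<dots> = (t k * ?N k) * ((real (card S) - 1) * ?\<mu>)"
  proof -
    have "1 \<le> card S"
      using k card_gt_0_iff[of S] by auto
    then show ?thesis
      using k by (simp add: of_nat_diff)
  qed
  finally show ?thesis
    using tk Nk by simp
qed

section \<open>Multiplication by a nonsingular matrix\<close>

lemma column_matrix_mul:
  fixes W :: "real^'k^'m" and A :: "real^'n^'k"
  shows "column j (W ** A) = W *v column j A"
  by (simp add: column_def matrix_matrix_mult_def matrix_vector_mult_def vec_eq_iff)

lemma columns_dependent_matrix_mul:
  fixes W :: "real^'k^'m" and A :: "real^'n^'k"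
  assumes "columns_dependent A S"
  shows "columns_dependent (W ** A) S"
proof -
  obtain c where c: "\<exists>j\<in>S. c j \<noteq> 0" and rel: "(\<Sum>j\<in>S. c j *\<^sub>R column j A) = 0"
    using assms unfolding columns_dependent_def by blast
  have "(\<Sum>j\<in>S. c j *\<^sub>R column j (W ** A)) = W *v (\<Sum>j\<in>S. c j *\<^sub>R column j A)"
    by (simp add: column_matrix_mul linear_sum[OF matrix_vector_mul_linear]
        linear_cmul[OF matrix_vector_mul_linear])
  with c rel show ?thesis
    unfolding columns_dependent_def by auto
qed

lemma dependent_columns_scaled_coherence:
  fixes A :: "real^'n^'m" and W :: "real^'m^'m"
  assumes "\<And>j. column j A \<noteq> 0" and "invertible W" and "columns_dependent A S"
  shows "1 \<le> (real (card S) - 1) * scaled_coherence W A"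
  unfolding scaled_coherence_def
proof (rule dependent_columns_coherence)
  show "column j (W ** A) \<noteq> 0" for j
    using assms(1)[of j] inj_matrix_vector_mult[OF assms(2)]
    by (metis column_matrix_mul injD matrix_vector_mult_0_right)
  show "columns_dependent (W ** A) S"
    using assms(3) by (rule columns_dependent_matrix_mul)
qed

section \<open>Spark and sparse solutions\<close>

lemma columns_dependent_support:
  fixes A :: "real^'n^'m"
  assumes "A *v z = 0" and "z \<noteq> 0"
  shows "columns_dependent A {i. z $ i \<noteq> 0}"
proof -
  have "(\<Sum>j\<in>{i. z $ i \<noteq> 0}. z $ j *\<^sub>R column j A) = (\<Sum>j\<in>UNIV. z $ j *\<^sub>R column j A)"
    by (rule sum.mono_neutral_left) auto
  also have "\<dots> = A *v z"
    by (simp add: matrix_mult_sum scalar_mult_eq_scaleR)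
  finally show ?thesis
    using assms unfolding columns_dependent_def by (auto simp: vec_eq_iff)
qed

lemma spark_le_card:
  "columns_dependent A S \<Longrightarrow> spark A \<le> card S"
  unfolding spark_def by (rule Least_le) blast

lemma spark_attained:
  assumes "columns_dependent A S"
  obtains T where "card T = spark A" and "columns_dependent A T"
proof -
  have "\<exists>T. card T = spark A \<and> columns_dependent A T"
    unfolding spark_def
    by (rule LeastI[where P = "\<lambda>k. \<exists>T. card T = k \<and> columns_dependent A T"]) (use assms in blast)
  with that show thesis
    by blast
qed

lemma wide_matrix_columns_dependent:
  fixes A :: "real^'n^'m"
  assumes "CARD('m) < CARD('n)"
  obtains S where "columns_dependent A S"
proof -
  have "rank A < CARD('n)"
    using assms rank_bound[of A] by simp
  then have "\<not> inj ((*v) A)"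
    using less_rank_noninjective by blast
  then obtain z where "A *v z = 0" "z \<noteq> 0"
    using linear_injective_0[OF matrix_vector_mul_linear] by blast
  with that show thesis
    using columns_dependent_support by blast
qed

lemma l0_diff_le:
  fixes x y :: "real^'n"
  shows "l0 (x - y) \<le> l0 x + l0 y"
proof -
  have "l0 (x - y) \<le> card ({i. x $ i \<noteq> 0} \<union> {i. y $ i \<noteq> 0})"
    unfolding l0_def by (rule card_mono) auto
  also have "\<dots> \<le> l0 x + l0 y"
    unfolding l0_def by (rule card_Un_le)
  finally show ?thesis .
qed

text \<open>A competitor that is no less sparse would make the difference, a nonzero vector of the kernel,
  too sparse for its support to be a dependent set of columns.\<close>

lemma unique_sparsest_solution_if_l0_less_spark:
  fixes A :: "real^'n^'m"
  assumes "A *v x = b" and "2 * l0 x < spark A"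
  shows "unique_sparsest_solution A b x"
  unfolding unique_sparsest_solution_def
proof (intro conjI allI impI)
  fix y
  assume y: "A *v y = b \<and> y \<noteq> x"
  have "columns_dependent A {i. (x - y) $ i \<noteq> 0}"
    using assms(1) y by (intro columns_dependent_support) (auto simp: matrix_vector_mult_diff_distrib)
  then have "spark A \<le> l0 (x - y)"
    unfolding l0_def by (rule spark_le_card)
  with assms(2) l0_diff_le[of x y] show "l0 x < l0 y"
    by linarith
qed (use assms in simp)

section \<open>Optimal scaled coherence and sparsest solutions\<close>

theorem theorem4p2:
  fixes A :: "real^'n^'m"
  assumes "2 \<le> CARD('m)" and "CARD('m) < CARD('n)"
    and "\<forall>j. column j A \<noteq> 0"
  shows "optimal_coherence A > 0 \<and>
    (\<forall>W :: real^'m^'m. invertible W \<longrightarrow>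
       1 + 1 / scaled_coherence W A \<le> 1 + 1 / optimal_coherence A \<and>
       1 + 1 / optimal_coherence A \<le> real (spark A)) \<and>
    (\<forall>(b :: real^'m) (x :: real^'n). A *v x = b \<longrightarrow>
       (real (l0 x) < (1 + 1 / optimal_coherence A) / 2 \<longrightarrow> unique_sparsest_solution A b x) \<and>
       ((\<exists>W :: real^'m^'m. invertible W \<and> real (l0 x) < (1 + 1 / scaled_coherence W A) / 2) \<longrightarrow>
          unique_sparsest_solution A b x))"
proof -
  let ?K = "{scaled_coherence W A | W. invertible W}" and ?s = "real (spark A) - 1"
  obtain S where "columns_dependent A S"
    using wide_matrix_columns_dependent[OF assms(2)] .
  then obtain T where T: "card T = spark A" "columns_dependent A T"
    by (rule spark_attained)
  have bound: "1 \<le> ?s * scaled_coherence W A" if "invertible W" for W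
    using dependent_columns_scaled_coherence[of A W T] assms(3) that T by simp
  \<comment> \<open>The identity matrix shows both that the spark is not \<open>1\<close> and that the infimum is over a
    nonempty set.\<close>
  have id: "invertible (mat 1 :: real^'m^'m)"
    unfolding invertible_def by (intro exI[of _ "mat 1"]) simp
  have "T \<noteq> {}"
    using T(2) unfolding columns_dependent_def by auto
  then have "0 \<le> ?s"
    using T(1) card_gt_0_iff[of T] by auto
  moreover have "?s \<noteq> 0"
    using bound[OF id] by auto
  ultimately have s: "0 < ?s"
    by linarith
  have lower: "1 / ?s \<le> \<kappa>" if "\<kappa> \<in> ?K" for \<kappa>
    using that bound s by (auto simp: pos_divide_le_eq mult.commute)
  have "?K \<noteq> {}"
    using id by blast
  then have opt: "1 / ?s \<le> optimal_coherence A"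
    unfolding optimal_coherence_def using lower by (rule cInf_greatest)
  have pos: "0 < optimal_coherence A"
    using opt s by (meson divide_pos_pos less_le_trans zero_less_one)
  have "optimal_coherence A \<le> scaled_coherence W A" if "invertible W" for W
    unfolding optimal_coherence_def
  proof (rule cInf_lower)
    show "bdd_below ?K"
      using lower by (rule bdd_belowI)
  qed (use that in blast)
  then have le_opt: "1 + 1 / scaled_coherence W A \<le> 1 + 1 / optimal_coherence A"
    if "invertible W" for W
    using pos that by (simp add: frac_le)
  have "1 \<le> ?s * optimal_coherence A"
    using opt s by (simp add: pos_divide_le_eq mult.commute)
  then have "1 / optimal_coherence A \<le> ?s"
    using pos by (simp add: pos_divide_le_eq)
  then have le_spark: "1 + 1 / optimal_coherence A \<le> real (spark A)"
    by simp
  have unique: "unique_sparsest_solution A b x"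
    if "A *v x = b" "real (l0 x) < (1 + 1 / optimal_coherence A) / 2" for b x
    using that(1)
  proof (rule unique_sparsest_solution_if_l0_less_spark)
    have "real (l0 x) < real (spark A) / 2"
      using that(2) divide_right_mono[OF le_spark, of 2] by (rule less_le_trans) simp
    then show "2 * l0 x < spark A"
      by linarith
  qed
  have "unique_sparsest_solution A b x"
    if "A *v x = b" "invertible W" "real (l0 x) < (1 + 1 / scaled_coherence W A) / 2" for b x W
  proof (rule unique[OF that(1)])
    show "real (l0 x) < (1 + 1 / optimal_coherence A) / 2"
      using that(3) divide_right_mono[OF le_opt[OF that(2)], of 2] by (rule less_le_trans) simp
  qed
  with pos le_opt le_spark unique show ?thesis
    by blast
qed

end
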